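(* Let $\mu,\alpha,\beta,\gamma\ge0$ and define $$\mathcal{R}_3'=\{\mathbf{Y}\in\mathbb{R}^{p\times r}_*:\|\overline{\mathrm{grad}\,H([\mathbf{Y}])}\|_F>\alpha\mu\sigma_r^3(\mathbf{Y}^* )/(4\kappa^* ),\ \|\mathbf{Y}\|\le\beta\|\mathbf{Y}^*\|,\ \|\mathbf{Y}\mathbf{Y}^\top\|_F\le\gamma\|\mathbf{Y}^*\mathbf{Y}^{*\top}\|_F\},$$ $$\mathcal{R}_3''=\{\mathbf{Y}\in\mathbb{R}^{p\times r}_*:\|\mathbf{Y}\|>\beta\|\mathbf{Y}^*\|,\ \|\mathbf{Y}\mathbf{Y}^\top\|_F\le\gamma\|\mathbf{Y}^*\mathbf{Y}^{*\top}\|_F\},\qquad\mathcal{R}_3'''=\{\mathbf{Y}\in\mathbb{R}^{p\times r}_*:\|\mathbf{Y}\mathbf{Y}^\top\|_F>\gamma\|\mathbf{Y}^*\mathbf{Y}^{*\top}\|_F\}.$$ Then: (i) $\|\overline{\mathrm{grad}\,H([\mathbf{Y}])}\|_F>\alpha\mu\sigma_r^3(\mathbf{Y}^* )/(4\kappa^* )$ for all $\mathbf{Y}\in\mathcal{R}_3'$; (ii) $\|\overline{\mathrm{grad}\,H([\mathbf{Y}])}\|_F\ge2(\|\mathbf{Y}\|^3-\|\mathbf{Y}\|\|\mathbf{Y}^*\|^2)>2(\beta^3-\beta)\|\mathbf{Y}^*\|^3$ for all $\mathbf{Y}\in\mathcal{R}_3''$; (iii) $\langle\overline{\mathrm{grad}\,H([\mathbf{Y}])},\mathbf{Y}\rangle>2(1-1/\gamma)\|\mathbf{Y}\mathbf{Y}^\top\|_F^2$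 for all $\mathbf{Y}\in\mathcal{R}_3'''$. In particular, if $\beta>1$ and $\gamma>1$, the Riemannian gradient of $H([\mathbf{Y}])$ has large magnitude in all the regions $\mathcal{R}_3',\mathcal{R}_3''$ and $\mathcal{R}_3'''$.
   Context: Let $0<r\le p$ be integers. $\|\cdot\|$, $\|\cdot\|_F$ are the spectral and Frobenius norms, $\langle\mathbf{A},\mathbf{B}\rangle=\mathrm{tr}(\mathbf{A}^\top\mathbf{B})$, and $\sigma_i(\cdot)$ is the $i$-th largest singular value. $\mathbb{R}^{p\times r}_*$ is the set of real $p\times r$ matrices of full column rank, $\mathbb{O}_r$ the orthogonal group, and $\mathcal{M}=\mathbb{R}^{p\times r}_*/\mathbb{O}_r$ the quotient manifold with points $[\mathbf{Y}]=\{\mathbf{Y}\mathbf{O}:\mathbf{O}\in\mathbb{O}_r\}$ and the Riemannian metric induced from $\mathrm{tr}(\eta^\top\theta)$. $\mathbf{X}^*=\mathbf{Y}^*\mathbf{Y}^{*\top}$ is a symmetric positive semidefinite $p\times p$ matrix of rank $r$, with $\mathbf{Y}^*\in\mathbb{R}^{p\times r}_*$ and $\kappa^*=\sigma_1(\mathbf{Y}^* )/\sigma_r(\mathbf{Y}^* )$. $H([\mathbf{Y}])=\frac12\|\mathbf{Y}\mathbf{Y}^\top-\mathbf{X}^*\|_F^2$ on $\mathcal{M}$, and the horizontal lift of its Riemannian gradient is $\overline{\mathrm{grad}\,H([\mathbf{Y}])}=2(\mathbf{Y}\mathbf{Y}^\top-\mathbf{X}^* )\mathbf{Y}$.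
   Formalization: The second inequality in (ii) is stated for β ≥ 1/√3, since it fails below (p=r=1, Y*=1, β=0, γ=1, Y=1/2); the resulting bound ‖grad H‖_F > 2(β³−β)‖Y*‖³ is stated for all β > 0. Part (iii) is stated for γ > 0, as 1/γ is undefined at γ = 0. *)

theory Defs
  imports "HOL-Analysis.Analysis" "HOL-Computational_Algebra.Polynomial"
begin

text \<open>
  A real \<open>p \<times> r\<close> matrix is a term of type \<open>real^'r^'p\<close>. On this type the library's
  \<^const>\<open>norm\<close> is the Frobenius norm, see \<open>norm_eq_frobenius\<close> below;
  the spectral norm is the operator norm \<^const>\<open>onorm\<close> of the induced linear map.
\<close>

definition finner :: "real^'n^'m \<Rightarrow> real^'n^'m \<Rightarrow> real" where
  "finner A B = trace (transpose A ** B)"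

definition spectral_norm :: "real^'n^'m \<Rightarrow> real" where
  "spectral_norm A = onorm (\<lambda>x. A *v x)"

lemma finner_eq_inner: "finner A B = A \<bullet> B"
proof -
  have "finner A B = (\<Sum>j\<in>UNIV. \<Sum>i\<in>UNIV. A$i$j * B$i$j)"
    by (simp add: finner_def trace_def matrix_matrix_mult_def transpose_def)
  also have "\<dots> = (\<Sum>i\<in>UNIV. \<Sum>j\<in>UNIV. A$i$j * B$i$j)"
    by (rule sum.swap)
  finally show ?thesis by (simp add: inner_vec_def)
qed

lemma norm_eq_frobenius: "norm (A :: real^'n^'m) = sqrt (finner A A)"
  by (simp add: finner_eq_inner norm_eq_sqrt_inner)


definition charpoly :: "real^'n^'n \<Rightarrow> real poly" where
  "charpoly A = det (\<chi> i j. [: - (A$i$j), (if i = j then 1 else 0) :])"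

text \<open>
  \<open>sing_val A i\<close> is the \<open>i\<close>-th largest singular value, counted from \<open>1\<close> and with multiplicity.
  It is meaningful for \<open>1 \<le> i \<le> n\<close>, where \<open>n\<close> is the number of columns of \<open>A\<close>.
\<close>

definition sing_val :: "real^'n^'m \<Rightarrow> nat \<Rightarrow> real" where
  "sing_val A i =
     sqrt (rev (sorted_list_of_multiset (proots (charpoly (transpose A ** A)))) ! (i - 1))"

definition full_col_rank :: "(real^'r^'p) set" where
  "full_col_rank = {Y. rank Y = CARD('r)}"

definition kappa :: "real^'r^'p \<Rightarrow> real" where
  "kappa Y = sing_val Y 1 / sing_val Y CARD('r)"


text \<open>
  The quotient by the right action of the orthogonal group. A tangent vector at \<open>orbit Y\<close> is
  represented by its horizontal lift at \<open>Y\<close>. The vertical space is the tangent space of the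
  fibre through \<open>Y\<close>, the horizontal space its orthogonal complement.
\<close>

definition orbit :: "real^'r^'p \<Rightarrow> (real^'r^'p) set" where
  "orbit Y = {Y ** Q | Q. orthogonal_matrix Q}"

definition vertical :: "real^'r^'p \<Rightarrow> (real^'r^'p) set" where
  "vertical Y = {Y ** \<Omega> | \<Omega>. transpose \<Omega> = - \<Omega>}"

definition horizontal :: "real^'r^'p \<Rightarrow> (real^'r^'p) set" where
  "horizontal Y = {\<theta>. \<forall>\<eta>\<in>vertical Y. finner \<eta> \<theta> = 0}"

text \<open>
  Since the metric on the quotient is \<open>finner\<close> on horizontal lifts, the horizontal lift of the
  Riemannian gradient of \<open>F\<close> is the horizontal vector representing the differential of
  \<open>\<lambda>Z. F (orbit Z)\<close> on horizontal directions, and the Riemannian norm of the gradient is the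
  Frobenius norm of this lift.
\<close>

definition hlift_grad :: "((real^'r^'p) set \<Rightarrow> real) \<Rightarrow> real^'r^'p \<Rightarrow> real^'r^'p" where
  "hlift_grad F Y = (THE \<xi>. \<xi> \<in> horizontal Y \<and>
     (\<exists>D. ((\<lambda>Z. F (orbit Z)) has_derivative D) (at Y) \<and>
          (\<forall>\<theta>\<in>horizontal Y. D \<theta> = finner \<xi> \<theta>)))"

text \<open>The description in \<open>H\<close> is proper: \<open>Y ** transpose Y\<close> is constant on orbits, see \<open>H_orbit\<close>.\<close>

definition H :: "real^'r^'p \<Rightarrow> (real^'r^'p) set \<Rightarrow> real" where
  "H Ys c = (THE h. \<forall>Y\<in>c. h = (norm (Y ** transpose Y - Ys ** transpose Ys))\<^sup>2 / 2)"

definition grad_H :: "real^'r^'p \<Rightarrow> real^'r^'p \<Rightarrow> real^'r^'p" where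
  "grad_H Ys Y = hlift_grad (H Ys) Y"


definition R3_1 :: "real \<Rightarrow> real \<Rightarrow> real \<Rightarrow> real \<Rightarrow> real^'r^'p \<Rightarrow> (real^'r^'p) set" where
  "R3_1 \<mu> \<alpha> \<beta> \<gamma> Ys = {Y \<in> full_col_rank.
     norm (grad_H Ys Y) > \<alpha> * \<mu> * sing_val Ys CARD('r) ^ 3 / (4 * kappa Ys) \<and>
     spectral_norm Y \<le> \<beta> * spectral_norm Ys \<and>
     norm (Y ** transpose Y) \<le> \<gamma> * norm (Ys ** transpose Ys)}"

definition R3_2 :: "real \<Rightarrow> real \<Rightarrow> real^'r^'p \<Rightarrow> (real^'r^'p) set" where
  "R3_2 \<beta> \<gamma> Ys = {Y \<in> full_col_rank.
     spectral_norm Y > \<beta> * spectral_norm Ys \<and>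
     norm (Y ** transpose Y) \<le> \<gamma> * norm (Ys ** transpose Ys)}"

definition R3_3 :: "real \<Rightarrow> real^'r^'p \<Rightarrow> (real^'r^'p) set" where
  "R3_3 \<gamma> Ys = {Y \<in> full_col_rank.
     norm (Y ** transpose Y) > \<gamma> * norm (Ys ** transpose Ys)}"


lemma H_orbit: "H Ys (orbit Y) = (norm (Y ** transpose Y - Ys ** transpose Ys))\<^sup>2 / 2"
proof -
  have inv: "Z ** transpose Z = Y ** transpose Y" if Z: "Z \<in> orbit Y" for Z
  proof -
    obtain Q where Q: "Z = Y ** Q" "orthogonal_matrix Q" using Z by (auto simp: orbit_def)
    have "Z ** transpose Z = Y ** (Q ** transpose Q) ** transpose Y"
      by (simp add: Q(1) matrix_transpose_mul matrix_mul_assoc)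
    then show ?thesis using Q(2) by (simp add: orthogonal_matrix_def)
  qed
  have "Y ** mat 1 \<in> orbit Y"
    unfolding orbit_def using orthogonal_matrix_id by blast
  then have "Y \<in> orbit Y" by simp
  then show ?thesis
    unfolding H_def using inv by (intro the_equality) metis+
qed

lemma inner_transpose: "transpose A \<bullet> transpose B = (A :: real^'n^'m) \<bullet> B"
proof -
  have "transpose A \<bullet> transpose B = trace (A ** transpose B)"
    by (simp flip: finner_eq_inner add: finner_def)
  also have "\<dots> = trace (transpose B ** A)" by (rule trace_mul_sym)
  also have "\<dots> = B \<bullet> A" by (simp add: finner_def flip: finner_eq_inner)
  finally show ?thesis by (simp add: inner_commute)
qed

lemma inner_mult_right: "A \<bullet> (B ** C) = (A ** transpose C) \<bullet> (B :: real^'n^'m)"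
proof -
  have "A \<bullet> (B ** C) = trace ((transpose A ** B) ** C)"
    by (simp flip: finner_eq_inner add: finner_def matrix_mul_assoc)
  also have "\<dots> = trace (C ** (transpose A ** B))" by (rule trace_mul_sym)
  also have "\<dots> = finner (A ** transpose C) B"
    by (simp add: finner_def matrix_transpose_mul matrix_mul_assoc)
  finally show ?thesis by (simp add: finner_eq_inner)
qed

lemma bounded_bilinear_matrix_mult:
  "bounded_bilinear ((**) :: real^'n^'m \<Rightarrow> real^'k^'n \<Rightarrow> real^'k^'m)"
proof -
  have "bilinear ((**) :: real^'n^'m \<Rightarrow> real^'k^'n \<Rightarrow> real^'k^'m)"
    unfolding bilinear_def
    by (auto intro!: linearI simp: vec_eq_iff matrix_matrix_mult_def algebra_simps
        sum.distrib sum_distrib_left)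
  then show ?thesis by (simp add: bilinear_conv_bounded_bilinear)
qed

lemma bounded_linear_transpose: "bounded_linear (transpose :: real^'n^'m \<Rightarrow> real^'m^'n)"
  unfolding linear_conv_bounded_linear[symmetric]
  by (intro linearI) (simp_all add: vec_eq_iff transpose_def)

lemma H_has_derivative:
  fixes Y Ys :: "real^'r^'p"
  defines "E \<equiv> Y ** transpose Y - Ys ** transpose Ys"
  shows "((\<lambda>Z. H Ys (orbit Z)) has_derivative (\<lambda>\<theta>. finner (2 *\<^sub>R (E ** Y)) \<theta>)) (at Y)"
proof -
  have tE: "transpose E = E"
  proof -
    have "transpose (A - B) = transpose A - transpose B" for A B :: "real^'p^'p"
      by (simp add: vec_eq_iff transpose_def)
    then show ?thesis by (simp add: E_def matrix_transpose_mul)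
  qed
  have d: "((\<lambda>Z. Z ** transpose Z - Ys ** transpose Ys) has_derivative
      (\<lambda>\<theta>. Y ** transpose \<theta> + \<theta> ** transpose Y)) (at Y)"
    using has_derivative_diff[OF bounded_bilinear.FDERIV[OF bounded_bilinear_matrix_mult
        has_derivative_ident bounded_linear.has_derivative[OF bounded_linear_transpose
          has_derivative_ident]] has_derivative_const]
    by simp
  have s: "E \<bullet> (Y ** transpose \<theta>) = (E ** Y) \<bullet> \<theta>" "E \<bullet> (\<theta> ** transpose Y) = (E ** Y) \<bullet> \<theta>" for \<theta>
  proof -
    show 2: "E \<bullet> (\<theta> ** transpose Y) = (E ** Y) \<bullet> \<theta>"
      by (simp add: inner_mult_right)
    have "E \<bullet> (Y ** transpose \<theta>) = transpose E \<bullet> transpose (Y ** transpose \<theta>)"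
      by (simp only: inner_transpose)
    also have "\<dots> = E \<bullet> (\<theta> ** transpose Y)" by (simp add: tE matrix_transpose_mul)
    finally show "E \<bullet> (Y ** transpose \<theta>) = (E ** Y) \<bullet> \<theta>" using 2 by simp
  qed
  have "((\<lambda>Z. ((Z ** transpose Z - Ys ** transpose Ys) \<bullet> (Z ** transpose Z - Ys ** transpose Ys)) / 2)
      has_derivative (\<lambda>\<theta>. (E \<bullet> (Y ** transpose \<theta> + \<theta> ** transpose Y)
        + (Y ** transpose \<theta> + \<theta> ** transpose Y) \<bullet> E) / 2)) (at Y)"
    unfolding E_def
    by (rule bounded_linear.has_derivative[OF bounded_linear_divide has_derivative_inner[OF d d]])
  moreover have "(\<lambda>\<theta>. (E \<bullet> (Y ** transpose \<theta> + \<theta> ** transpose Y)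
        + (Y ** transpose \<theta> + \<theta> ** transpose Y) \<bullet> E) / 2) = (\<lambda>\<theta>. finner (2 *\<^sub>R (E ** Y)) \<theta>)"
    by (simp add: fun_eq_iff finner_eq_inner inner_commute[of _ E] inner_add_right s)
  ultimately show ?thesis by (simp add: H_orbit power2_norm_eq_inner)
qed

lemma grad_H_eq:
  fixes Y Ys :: "real^'r^'p"
  shows "grad_H Ys Y = 2 *\<^sub>R ((Y ** transpose Y - Ys ** transpose Ys) ** Y)"
proof -
  define E where "E = Y ** transpose Y - Ys ** transpose Ys"
  let ?G = "2 *\<^sub>R (E ** Y)"
  note d = H_has_derivative[of Ys Y, folded E_def]
  have tE: "transpose E = E"
  proof -
    have "transpose (A - B) = transpose A - transpose B" for A B :: "real^'p^'p"
      by (simp add: vec_eq_iff transpose_def)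
    then show ?thesis by (simp add: E_def matrix_transpose_mul)
  qed
  have hor: "?G \<in> horizontal Y"
    unfolding horizontal_def
  proof (clarsimp simp: vertical_def finner_eq_inner)
    fix \<Omega> :: "real^'r^'r" assume \<Omega>: "transpose \<Omega> = - \<Omega>"
    let ?W = "Y ** \<Omega> ** transpose Y"
    have "(Y ** \<Omega>) \<bullet> (E ** Y) = ?W \<bullet> E"
      by (metis inner_mult_right)
    moreover have "transpose ?W = - ?W"
    proof -
      have "transpose ?W = Y ** transpose \<Omega> ** transpose Y"
        by (simp add: matrix_transpose_mul matrix_mul_assoc)
      also have "\<dots> = - ?W"
        unfolding \<Omega> by (simp add: vec_eq_iff matrix_matrix_mult_def sum_negf)
      finally show ?thesis .
    qed
    then have "?W \<bullet> E = - (?W \<bullet> E)" using inner_transpose[of ?W E] tE by simp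
    ultimately show "(Y ** \<Omega>) \<bullet> (E ** Y) = 0" by simp
  qed
  show ?thesis
    unfolding grad_H_def hlift_grad_def E_def[symmetric]
  proof (rule the_equality)
    show "?G \<in> horizontal Y \<and>
     (\<exists>D. ((\<lambda>Z. H Ys (orbit Z)) has_derivative D) (at Y) \<and>
          (\<forall>\<theta>\<in>horizontal Y. D \<theta> = finner ?G \<theta>))"
      using hor d by blast
  next
    fix \<xi> assume a: "\<xi> \<in> horizontal Y \<and>
     (\<exists>D. ((\<lambda>Z. H Ys (orbit Z)) has_derivative D) (at Y) \<and>
          (\<forall>\<theta>\<in>horizontal Y. D \<theta> = finner \<xi> \<theta>))"
    then have *: "finner ?G \<theta> = finner \<xi> \<theta>" if "\<theta> \<in> horizontal Y" for \<theta>
      using has_derivative_unique[OF d] that by (metis (no_types, lifting))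
    have "\<xi> - ?G \<in> horizontal Y"
      using a hor by (simp add: horizontal_def finner_eq_inner inner_diff_right)
    from *[OF this] have "(\<xi> - ?G) \<bullet> (\<xi> - ?G) = 0"
      by (simp add: finner_eq_inner inner_diff_left)
    then show "\<xi> = ?G" by (simp only: inner_eq_zero_iff right_minus_eq)
  qed
qed

end

theory Submission
  imports Defs "HOL-Complex_Analysis.Cauchy_Integral_Formula"
begin

text \<open>
  Testing the gradient against rank-one matrices bounds it below by the cubic
  \<open>2 (s\<^sup>3 - s t\<^sup>2)\<close> in \<open>s = \<parallel>Y\<parallel>\<close>, \<open>t = \<parallel>Ys\<parallel>\<close>, which is strictly increasing for \<open>s \<ge> t / \<surd>3\<close>.
  Testing it against \<open>Y\<close> and using Cauchy--Schwarz for the term \<open>\<langle>Ys Ys\<^sup>\<top>, Y Y\<^sup>\<top>\<rangle>\<close> gives the third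
  region; there a bound on the norm of the gradient follows from \<open>\<parallel>Y\<parallel>\<^sub>F\<^sup>2 \<le> \<surd>r \<parallel>Y Y\<^sup>\<top>\<parallel>\<^sub>F\<close>.

  As \<open>sing_val\<close> indexes into a list of roots, its positivity needs that the
  characteristic polynomial of the Gram matrix splits over the reals: over the complex numbers it
  has as many roots as its degree, and those of a symmetric matrix are real.
\<close>

section \<open>Roots and degree of the characteristic polynomial\<close>

lemma poly_map_poly_of_real_add:
  fixes z :: "'a::real_field"
  shows "poly (map_poly of_real (p + q)) z = poly (map_poly of_real p) z + poly (map_poly of_real q) z"
proof -
  have "map_poly of_real (p + q) = map_poly of_real p + (map_poly of_real q :: 'a poly)"
    by (intro poly_eqI) (simp add: coeff_map_poly)
  then show ?thesis by simp
qed

lemma poly_map_poly_of_real_mult: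
  fixes z :: "'a::real_field"
  shows "poly (map_poly of_real (p * q)) z = poly (map_poly of_real p) z * poly (map_poly of_real q) z"
proof -
  have "map_poly of_real (p * q) = map_poly of_real p * (map_poly of_real q :: 'a poly)"
    by (intro poly_eqI) (simp add: coeff_map_poly coeff_mult)
  then show ?thesis by simp
qed

text \<open>The Leibniz formula is a polynomial in the entries with integer coefficients. Applied to
  evaluation after extension of scalars, it turns the polynomial determinant in
  \<open>charpoly\<close> into \<open>det (z I - A)\<close>.\<close>

lemma det_hom:
  fixes h :: "'a::comm_ring_1 \<Rightarrow> 'b::comm_ring_1" and M :: "'a^'n^'n"
  assumes add: "\<And>x y. h (x + y) = h x + h y"
    and mult: "\<And>x y. h (x * y) = h x * h y" and one: "h 1 = 1"
  shows "h (det M) = det (\<chi> i j. h (M$i$j))"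
proof -
  have zero: "h 0 = 0" using add[of 0 0] by simp
  have minus: "h (- x) = - h x" for x
    using add[of x "- x"] zero by (simp add: eq_neg_iff_add_eq_0 add.commute)
  have hsum: "h (sum f S) = (\<Sum>x\<in>S. h (f x))" for f :: "('n \<Rightarrow> 'n) \<Rightarrow> 'a" and S
    by (induction S rule: infinite_finite_induct) (auto simp: zero add)
  have hprod: "h (prod f S) = (\<Prod>x\<in>S. h (f x))" for f :: "'n \<Rightarrow> 'a" and S
    by (induction S rule: infinite_finite_induct) (auto simp: one mult)
  have sgn: "h (of_int (sign p)) = of_int (sign p)" for p :: "'n \<Rightarrow> 'n"
    by (cases p rule: sign_cases) (auto simp: one minus)
  show ?thesis
    by (simp add: det_def hsum mult sgn hprod)
qed

text \<open>At a root, \<open>z I - A\<close> is singular and so has a nonzero kernel vector. The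
  scalar type is general because complex roots are needed to show realness and real ones to show
  positivity.\<close>

lemma charpoly_root_eigenvector:
  fixes A :: "real^'n^'n" and z :: "'a::real_field"
  assumes "poly (map_poly of_real (charpoly A)) z = 0"
  obtains v :: "'a^'n" where "v \<noteq> 0" "\<And>i. (\<Sum>j\<in>UNIV. of_real (A$i$j) * v$j) = z * v$i"
proof -
  define M :: "'a^'n^'n" where "M = (\<chi> i j. (if i = j then z else 0) - of_real (A$i$j))"
  have "poly (map_poly of_real (charpoly A)) z
      = det (\<chi> i j. poly (map_poly of_real ((\<chi> i j. [: - (A$i$j), (if i = j then 1 else 0) :])$i$j)) z)"
    unfolding charpoly_def
    by (rule det_hom) (simp_all add: poly_map_poly_of_real_add poly_map_poly_of_real_mult)
  also have "(\<chi> i j. poly (map_poly of_real ((\<chi> i j. [: - (A$i$j), (if i = j then 1 else 0) :])$i$j)) z) = M"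
    by (simp add: vec_eq_iff M_def map_poly_pCons)
  finally have "\<not> invertible M" using assms by (simp add: invertible_det_nz)
  then obtain v where v: "M *v v = 0" "v \<noteq> 0"
    by (auto simp: invertible_left_inverse matrix_left_invertible_ker)
  have "(\<Sum>j\<in>UNIV. of_real (A$i$j) * v$j) = z * v$i" for i
  proof -
    have "0 = (\<Sum>j\<in>UNIV. (if i = j then z * v$j else 0) - of_real (A$i$j) * v$j)"
      using arg_cong[OF v(1), of "\<lambda>w. w$i"]
      by (simp add: matrix_vector_mult_def M_def left_diff_distrib if_distrib[of "\<lambda>x. x * _"] cong: if_cong)
    then show ?thesis by (simp add: sum_subtractf)
  qed
  with v(2) show ?thesis using that by blast
qed

text \<open>For an eigenvector \<open>v\<close>, the Hermitian form \<open>q\<close> equals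
  \<open>z\<close> times the squared norm \<open>s\<close> of \<open>v\<close>, while symmetry of
  \<open>A\<close> makes \<open>q\<close> its own conjugate.\<close>

lemma charpoly_symmetric_root_real:
  fixes A :: "real^'n^'n" and z :: complex
  assumes sym: "transpose A = A" and root: "poly (map_poly of_real (charpoly A)) z = 0"
  shows "z \<in> \<real>"
proof -
  obtain v :: "complex^'n" where v: "v \<noteq> 0"
    and ev: "\<And>i. (\<Sum>j\<in>UNIV. of_real (A$i$j) * v$j) = z * v$i"
    using root by (rule charpoly_root_eigenvector) (rule that)
  have symA: "A$i$j = A$j$i" for i j
    using arg_cong[OF sym, of "\<lambda>M. M$j$i"] by (simp add: transpose_def)
  define q where "q = (\<Sum>i\<in>UNIV. \<Sum>j\<in>UNIV. cnj (v$i) * of_real (A$i$j) * v$j)"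
  define s where "s = (\<Sum>i\<in>UNIV. (cmod (v$i))\<^sup>2)"
  have "q = (\<Sum>i\<in>UNIV. cnj (v$i) * (\<Sum>j\<in>UNIV. of_real (A$i$j) * v$j))"
    by (simp add: q_def sum_distrib_left mult.assoc)
  also have "\<dots> = z * of_real s"
    unfolding ev s_def of_real_sum complex_norm_square by (subst sum_distrib_left) (simp add: mult_ac)
  finally have q: "q = z * of_real s" .
  have "cnj q = (\<Sum>i\<in>UNIV. \<Sum>j\<in>UNIV. cnj (v$j) * of_real (A$j$i) * v$i)"
    by (simp add: q_def mult_ac symA)
  also have "\<dots> = q" unfolding q_def by (rule sum.swap)
  finally have "cnj z * of_real s = z * of_real s" using q by simp
  moreover have "s \<noteq> 0"
    using v by (simp add: s_def sum_nonneg_eq_0_iff vec_eq_iff)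
  ultimately show ?thesis by (simp add: Reals_cnj_iff)
qed

text \<open>Induction on the degree: a complex root exists and is real by hypothesis, so a real
  linear factor splits off. The cofactor inherits the hypothesis because its roots are roots of
  \<open>p\<close>.\<close>

lemma size_proots_eq_degree_if_roots_real:
  fixes p :: "real poly"
  assumes "p \<noteq> 0" "\<And>z::complex. poly (map_poly of_real p) z = 0 \<Longrightarrow> z \<in> \<real>"
  shows "size (proots p) = degree p"
  using assms
proof (induction "degree p" arbitrary: p)
  case 0
  then show ?case using size_proots_le[of p] by simp
next
  case (Suc n)
  let ?P = "map_poly of_real p :: complex poly"
  have deg: "degree ?P = Suc n" using Suc.hyps(2) by (simp add: degree_map_poly)
  then have "?P \<noteq> 0" by (metis degree_0 nat.distinct(1))
  then have "lead_coeff ?P \<noteq> 0" by (simp only: leading_coeff_0_iff not_False_eq_True)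
  \<comment> \<open>The fundamental theorem of algebra is applied in a form asking for a nonzero
    coefficient of positive index; the leading one qualifies.\<close>
  then have "\<exists>i\<in>{1..degree ?P}. coeff ?P i \<noteq> 0"
    by (rule bexI) (simp add: deg)
  then obtain z where z: "poly ?P z = 0"
    using fundamental_theorem_of_algebra[of "coeff ?P" "degree ?P"] by (auto simp: poly_altdef)
  with Suc.prems(2) obtain x where x: "z = of_real x" by (auto simp: Reals_def)
  have "of_real (poly p x) = poly (map_poly of_real p) (of_real x :: complex)"
    by (induction p) (simp_all add: map_poly_pCons)
  then have "poly p x = 0" using z x by (metis of_real_eq_0_iff)
  then obtain q where q: "p = [:- x, 1:] * q" by (auto simp: poly_eq_0_iff_dvd)
  with Suc.prems have "q \<noteq> 0" by auto
  then have "degree p = Suc (degree q)" unfolding q by (subst degree_mult_eq) auto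
  moreover have "size (proots q) = degree q"
  proof (rule Suc.hyps(1))
    show "n = degree q" using Suc.hyps(2) calculation by simp
    show "z \<in> \<real>" if "poly (map_poly of_real q) z = 0" for z :: complex
      using that Suc.prems(2)[of z] by (simp add: q poly_map_poly_of_real_mult del: mult_pCons_left)
  qed fact
  moreover have "proots p = {#x#} + proots q"
    unfolding q using \<open>q \<noteq> 0\<close> by (subst proots_mult) auto
  ultimately show ?case by simp
qed

text \<open>In the Leibniz sum only the identity permutation multiplies \<open>n\<close> linear
  factors; any other one meets a constant off-diagonal entry and gives a smaller degree.\<close>

lemma degree_charpoly: "degree (charpoly (A :: real^'n^'n)) = CARD('n)"
proof -
  let ?M = "\<chi> i j. [: - (A$i$j), (if i = j then 1 else 0) :]"
  let ?t = "\<lambda>p. of_int (sign p) * (\<Prod>i\<in>UNIV. ?M$i$p i)"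
  have deg_id: "degree (?t id) = CARD('n)"
    by (simp add: sign_id degree_prod_sum_eq)
  have "degree (?t p) < CARD('n)" if p: "p \<noteq> id" for p :: "'n \<Rightarrow> 'n"
  proof -
    obtain i where i: "p i \<noteq> i" using p by (auto simp: fun_eq_iff)
    have "degree (?t p) = degree (\<Prod>i\<in>UNIV. ?M$i$p i)"
      by (cases p rule: sign_cases) auto
    also have "\<dots> \<le> (\<Sum>i\<in>UNIV. degree (?M$i$p i))"
      using degree_prod_sum_le[of UNIV "\<lambda>i. ?M$i$p i"] by (simp add: o_def)
    also have "\<dots> < (\<Sum>i\<in>(UNIV::'n set). 1)"
      by (rule sum_strict_mono_ex1) (use i in \<open>auto intro!: exI[of _ i]\<close>)
    finally show ?thesis by simp
  qed
  then have rest: "degree (\<Sum>p\<in>{p. p permutes UNIV} - {id}. ?t p) < CARD('n)"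
    by (intro degree_sum_less) auto
  have "charpoly A = ?t id + (\<Sum>p\<in>{p. p permutes UNIV} - {id}. ?t p)"
    unfolding charpoly_def det_def
    by (rule sum.remove) (simp_all add: permutes_id finite_permutations)
  then show ?thesis using degree_add_eq_left[of "sum ?t ({p. p permutes UNIV} - {id})" "?t id"] rest deg_id
    by simp
qed

section \<open>Positivity of singular values\<close>

lemma inner_transpose_mult_vector:
  fixes A :: "real^'n^'m"
  shows "x \<bullet> (transpose A *v y) = (A *v x) \<bullet> y"
  using dot_lmul_matrix[of y A x] by (simp add: inner_commute)

lemma full_col_rank_mult_eq_0_iff:
  fixes Y :: "real^'r^'p"
  assumes "Y \<in> full_col_rank"
  shows "Y *v x = 0 \<longleftrightarrow> x = 0"
proof -
  have "inj ((*v) Y)" using assms by (simp add: full_col_rank_def full_rank_injective)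
  then show ?thesis using injD[of "(*v) Y" x 0] by auto
qed

text \<open>The Gram matrix has \<open>CARD('r)\<close> real roots with multiplicity, so the index
  \<open>i - 1\<close> stays inside the list. Each root \<open>x\<close> is positive since
  \<open>x * (v \<bullet> v) = (Y *v v) \<bullet> (Y *v v)\<close> and \<open>Y\<close> is
  injective.\<close>

lemma sing_val_pos:
  fixes Y :: "real^'r^'p"
  assumes full: "Y \<in> full_col_rank" and i: "1 \<le> i" "i \<le> CARD('r)"
  shows "sing_val Y i > 0"
proof -
  define A where "A = transpose Y ** Y"
  let ?p = "charpoly A"
  have nz: "?p \<noteq> 0" using degree_charpoly[of A] by force
  have "transpose A = A" by (simp add: A_def matrix_transpose_mul)
  then have size: "size (proots ?p) = CARD('r)"
    using size_proots_eq_degree_if_roots_real[OF nz] charpoly_symmetric_root_real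
    by (metis degree_charpoly)
  have pos: "x > 0" if "x \<in># proots ?p" for x
  proof -
    \<comment> \<open>Over the reals \<open>of_real\<close> is the identity, so the eigenvector
      lemma yields a real \<open>v\<close>.\<close>
    have "map_poly of_real ?p = ?p" by (intro poly_eqI) (simp add: coeff_map_poly)
    then have "poly (map_poly of_real ?p) x = 0" using that nz by simp
    then obtain v :: "real^'r" where v: "v \<noteq> 0"
      and ev: "\<And>i. (\<Sum>j\<in>UNIV. of_real (A$i$j) * v$j) = x * v$i"
      by (rule charpoly_root_eigenvector) (rule that)
    have "A *v v = x *\<^sub>R v" using ev by (simp add: vec_eq_iff matrix_vector_mult_def)
    then have "x * (v \<bullet> v) = v \<bullet> (transpose Y *v (Y *v v))"
      by (simp add: A_def matrix_vector_mul_assoc)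
    also have "\<dots> = (Y *v v) \<bullet> (Y *v v)"
      by (rule inner_transpose_mult_vector)
    finally have "x * (v \<bullet> v) = (Y *v v) \<bullet> (Y *v v)" .
    moreover have "Y *v v \<noteq> 0"
      using v by (simp add: full_col_rank_mult_eq_0_iff[OF full])
    ultimately have "x * (v \<bullet> v) > 0" by simp
    then show ?thesis using inner_ge_zero[of v] by (metis zero_less_mult_pos2 mult_zero_right order_le_less)
  qed
  let ?l = "rev (sorted_list_of_multiset (proots ?p))"
  have "length ?l = CARD('r)" using size by (metis length_rev mset_sorted_list_of_multiset size_mset)
  then have "?l ! (i - 1) \<in> set ?l" using i by (intro nth_mem) simp
  then show ?thesis using pos by (simp add: sing_val_def A_def)
qed

lemma kappa_pos: "Y \<in> full_col_rank \<Longrightarrow> kappa (Y :: real^'r^'p) > 0"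
  by (simp add: kappa_def sing_val_pos Suc_leI)

section \<open>Spectral and Frobenius norm estimates\<close>

text \<open>The unit sphere is compact, and by homogeneity a maximum there bounds \<open>A\<close>
  on all vectors.\<close>

lemma spectral_norm_attained:
  fixes A :: "real^'n^'m"
  obtains v where "norm v = 1" "norm (A *v v) = spectral_norm A"
proof -
  have "sphere 0 1 \<noteq> ({} :: (real^'n) set)" by simp
  moreover have "continuous_on (sphere 0 1) (\<lambda>x. norm (A *v x))"
    by (intro continuous_intros linear_continuous_on matrix_vector_mul_bounded_linear)
  ultimately obtain v where v: "norm v = 1" and max: "\<And>x. norm x = 1 \<Longrightarrow> norm (A *v x) \<le> norm (A *v v)"
    using continuous_attains_sup[OF compact_sphere, of 0 1 "\<lambda>x. norm (A *v x)"] by auto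
  have "norm (A *v x) \<le> norm (A *v v) * norm x" for x
  proof (cases "x = 0")
    case False
    then show ?thesis
      using max[of "x /\<^sub>R norm x"] by (simp add: matrix_vector_mult_scaleR field_simps)
  qed simp
  then have "spectral_norm A \<le> norm (A *v v)"
    unfolding spectral_norm_def by (rule onorm_le)
  moreover have "norm (A *v v) \<le> spectral_norm A"
    using onorm[of "(*v) A" v] v by (simp add: spectral_norm_def)
  ultimately show ?thesis using that v by simp
qed

lemma spectral_norm_pos:
  fixes A :: "real^'n^'m"
  assumes "A \<in> full_col_rank"
  shows "spectral_norm A > 0"
proof -
  \<comment> \<open>Any nonzero vector serves; \<open>undefined\<close> is just some index.\<close>
  define x :: "real^'n" where "x = axis undefined 1"
  have x: "x \<noteq> 0" by (simp add: x_def axis_eq_0_iff)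
  have "A *v x \<noteq> 0"
    using x by (simp add: full_col_rank_mult_eq_0_iff[OF assms])
  then show ?thesis
    unfolding spectral_norm_def using onorm_pos_lt[of "(*v) A"] by auto
qed

text \<open>Pairing \<open>transpose A *v u\<close> with itself moves \<open>A\<close> to the other
  side, where Cauchy--Schwarz and the operator norm of \<open>A\<close> apply.\<close>

lemma norm_transpose_mult_vector_le:
  fixes A :: "real^'n^'m"
  shows "norm (transpose A *v u) \<le> spectral_norm A * norm u"
proof -
  let ?w = "transpose A *v u"
  have "norm ?w * norm ?w = (A *v ?w) \<bullet> u"
    by (metis inner_transpose_mult_vector norm_eq_sqrt_inner real_sqrt_mult_self abs_of_nonneg inner_ge_zero)
  also have "\<dots> \<le> norm (A *v ?w) * norm u" by (rule norm_cauchy_schwarz)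
  also have "\<dots> \<le> spectral_norm A * norm ?w * norm u"
    unfolding spectral_norm_def by (intro mult_right_mono onorm) auto
  finally have "norm ?w * norm ?w \<le> (spectral_norm A * norm u) * norm ?w" by (simp add: mult_ac)
  moreover have "0 \<le> spectral_norm A * norm u"
    by (simp add: spectral_norm_def onorm_pos_le)
  \<comment> \<open>If \<open>norm ?w = 0\<close>, nothing can be cancelled and nonnegativity of the
    right-hand side is used instead.\<close>
  ultimately show ?thesis by (metis mult_right_le_imp_le norm_ge_zero order_le_less)
qed

text \<open>Cauchy--Schwarz in each row; the Frobenius norm is the Euclidean norm of the row
  norms.\<close>

lemma norm_mult_vector_le_norm:
  fixes A :: "real^'n^'m"
  shows "norm (A *v x) \<le> norm A * norm x"
proof -
  have "norm (A *v x) = L2_set (\<lambda>i. norm (A$i \<bullet> x)) UNIV"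
    by (simp add: norm_vec_def matrix_vector_mul_component)
  also have "\<dots> \<le> L2_set (\<lambda>i. norm (A$i) * norm x) UNIV"
    by (rule L2_set_mono) (simp_all add: Cauchy_Schwarz_ineq2)
  also have "\<dots> = norm A * norm x"
    by (simp add: norm_vec_def L2_set_left_distrib)
  finally show ?thesis .
qed

section \<open>Lower bounds for the gradient\<close>

text \<open>
  The gradient is tested against \<open>u v\<^sup>\<top>\<close>, where \<open>v\<close> is a unit vector at which the spectral norm
  of \<open>Y\<close> is attained and \<open>u = Y v\<close>.
\<close>

lemma norm_grad_H_ge:
  fixes Y Ys :: "real^'r^'p"
  shows "norm (grad_H Ys Y)
    \<ge> 2 * (spectral_norm Y ^ 3 - spectral_norm Y * spectral_norm Ys ^ 2)"
proof -
  obtain v where v: "norm v = 1" "norm (Y *v v) = spectral_norm Y"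
    using spectral_norm_attained by metis
  define u where "u = Y *v v"
  define s where "s = spectral_norm Y"
  define t where "t = spectral_norm Ys"
  have u: "norm u = s" using v by (simp add: u_def s_def)
  then have s: "s \<ge> 0" by (metis norm_ge_zero)
  \<comment> \<open>Pairing \<open>transpose Y *v u\<close> with the unit vector \<open>v\<close>
    bounds its norm below by \<open>s\<^sup>2\<close>.\<close>
  have "u \<bullet> u = (transpose Y *v u) \<bullet> v"
    by (metis inner_transpose_mult_vector inner_commute u_def)
  also have "\<dots> \<le> norm (transpose Y *v u)"
    using norm_cauchy_schwarz[of "transpose Y *v u" v] v by simp
  finally have "s\<^sup>2 \<le> norm (transpose Y *v u)" using u by (simp add: dot_square_norm)
  then have low: "(s\<^sup>2)\<^sup>2 \<le> (norm (transpose Y *v u))\<^sup>2" by (intro power_mono) auto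
  have up: "(norm (transpose Ys *v u))\<^sup>2 \<le> (t * s)\<^sup>2"
    using norm_transpose_mult_vector_le[of Ys u] u by (intro power_mono) (simp_all add: t_def)
  have gram: "u \<bullet> ((Z ** transpose Z) *v u) = (norm (transpose Z *v u))\<^sup>2" for Z :: "real^'r^'p"
    using inner_transpose_mult_vector[of u "transpose Z" "transpose Z *v u"]
    by (simp only: matrix_vector_mul_assoc transpose_transpose dot_square_norm)
  have "2 * (s\<^sup>2 * s\<^sup>2 - (t * s)\<^sup>2)
      \<le> 2 * ((norm (transpose Y *v u))\<^sup>2 - (norm (transpose Ys *v u))\<^sup>2)"
    using low up by (simp add: power2_eq_square)
  \<comment> \<open>The factor \<open>Y\<close> at the right of the gradient sends \<open>v\<close>
    to \<open>u\<close>, leaving a difference of two Gram forms at \<open>u\<close>.\<close>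
  also have "\<dots> = u \<bullet> (grad_H Ys Y *v v)"
    using gram[of Y] gram[of Ys] unfolding grad_H_eq u_def
    by (simp add: scaleR_matrix_vector_assoc[symmetric] inner_diff_right
        matrix_vector_mult_diff_rdistrib flip: matrix_vector_mul_assoc)
  also have "\<dots> \<le> norm u * norm (grad_H Ys Y *v v)" by (rule norm_cauchy_schwarz)
  also have "\<dots> \<le> s * norm (grad_H Ys Y)"
    using norm_mult_vector_le_norm[of "grad_H Ys Y" v] v u s by (simp add: mult_left_mono)
  finally have "s * (2 * (s ^ 3 - s * t\<^sup>2)) \<le> s * norm (grad_H Ys Y)"
    by (simp add: algebra_simps power2_eq_square power3_eq_cube)
  \<comment> \<open>One factor \<open>s\<close> cancels; for \<open>s = 0\<close> the claim is that
    a norm is nonnegative.\<close>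
  then have "2 * (s ^ 3 - s * t\<^sup>2) \<le> norm (grad_H Ys Y)"
    using s by (cases "s = 0") auto
  then show ?thesis by (simp add: s_def t_def)
qed

text \<open>The pairing is \<open>2 * (P \<bullet> (P - X))\<close>, and
  \<open>norm X < norm P / \<gamma>\<close> controls the cross term. At \<open>\<gamma> = 0\<close>
  the convention \<open>1 / 0 = 0\<close> would make the claim false, as
  \<open>P \<bullet> X \<ge> 0\<close>.\<close>

lemma finner_grad_H_gt:
  fixes Y Ys :: "real^'r^'p"
  assumes \<gamma>: "\<gamma> > 0" and gt: "norm (Y ** transpose Y) > \<gamma> * norm (Ys ** transpose Ys)"
  shows "finner (grad_H Ys Y) Y > 2 * (1 - 1 / \<gamma>) * (norm (Y ** transpose Y))\<^sup>2"
proof -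
  define P where "P = Y ** transpose Y"
  define X where "X = Ys ** transpose Ys"
  have N: "norm P > 0" using \<gamma> gt unfolding P_def
    by (meson less_le_trans not_le mult_nonneg_nonneg norm_ge_zero order_less_imp_le order_le_less_trans)
  have "P \<bullet> X \<le> norm P * norm X" by (rule norm_cauchy_schwarz)
  also have "\<dots> < norm P * (norm P / \<gamma>)"
    using N gt \<gamma> by (intro mult_strict_left_mono) (simp_all add: P_def X_def field_simps)
  finally have "P \<bullet> X < (norm P)\<^sup>2 / \<gamma>" by (simp add: power2_eq_square)
  moreover have "finner (grad_H Ys Y) Y = 2 * (P \<bullet> (P - X))"
    by (simp add: finner_eq_inner grad_H_eq inner_mult_right inner_commute[of _ Y] P_def X_def)
  ultimately show ?thesis
    by (simp add: P_def[symmetric] inner_diff_right dot_square_norm algebra_simps)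
qed

text \<open>Both squared norms are traces of the same cyclic product.\<close>

lemma norm_gram_commute:
  fixes Y :: "real^'r^'p"
  shows "norm (transpose Y ** Y) = norm (Y ** transpose Y)"
proof -
  have "finner (transpose Y ** Y) (transpose Y ** Y) = trace ((transpose Y ** Y ** transpose Y) ** Y)"
    by (simp add: finner_def matrix_transpose_mul matrix_mul_assoc)
  also have "\<dots> = trace (Y ** (transpose Y ** Y ** transpose Y))" by (rule trace_mul_sym)
  also have "\<dots> = finner (Y ** transpose Y) (Y ** transpose Y)"
    by (simp add: finner_def matrix_transpose_mul matrix_mul_assoc)
  finally show ?thesis by (simp add: norm_eq_frobenius)
qed

text \<open>Cauchy--Schwarz for the identity and \<open>transpose Y ** Y\<close>. Using the Gram
  matrix of size \<open>r\<close> rather than \<open>p\<close> gives the constant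
  \<open>sqrt r\<close>.\<close>

lemma norm_power2_le_norm_gram:
  fixes Y :: "real^'r^'p"
  shows "(norm Y)\<^sup>2 \<le> sqrt CARD('r) * norm (Y ** transpose Y)"
proof -
  have "finner (mat 1 :: real^'r^'r) (mat 1) = CARD('r)"
    by (simp add: finner_def trace_I)
  then have "norm (mat 1 :: real^'r^'r) = sqrt CARD('r)" by (simp add: norm_eq_frobenius)
  moreover have "(norm Y)\<^sup>2 = mat 1 \<bullet> (transpose Y ** Y)"
    by (simp add: power2_norm_eq_inner finner_def flip: finner_eq_inner)
  ultimately show ?thesis
    using norm_cauchy_schwarz[of "mat 1" "transpose Y ** Y"] by (simp add: norm_gram_commute)
qed

text \<open>Cauchy--Schwarz turns the pairing bound into one on the norm, of order
  \<open>N powr (3/2)\<close>; replacing \<open>N\<close> by the smaller \<open>x\<close> makes it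
  independent of \<open>Y\<close>.\<close>

lemma norm_grad_H_gt:
  fixes Y Ys :: "real^'r^'p"
  assumes \<gamma>: "\<gamma> > 1" and gt: "norm (Y ** transpose Y) > \<gamma> * norm (Ys ** transpose Ys)"
  shows "norm (grad_H Ys Y) > 2 * (1 - 1 / \<gamma>) * (\<gamma> * norm (Ys ** transpose Ys)) powr (3/2)
    / real CARD('r) powr (1/4)"
proof -
  define N where "N = norm (Y ** transpose Y)"
  define x where "x = \<gamma> * norm (Ys ** transpose Ys)"
  define k where "k = 2 * (1 - 1 / \<gamma>)"
  define G where "G = norm (grad_H Ys Y)"
  define R where "R = real CARD('r) powr (1/4)"
  have x: "0 \<le> x" "x < N" using \<gamma> gt by (simp_all add: x_def N_def)
  have "1 / \<gamma> < 1" using \<gamma> by simp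
  then have k: "k > 0" by (simp add: k_def)
  have R: "R > 0" by (simp add: R_def)
  have "sqrt CARD('r) = R\<^sup>2"
    by (simp add: R_def powr_half_sqrt[symmetric] powr_powr flip: powr_realpow)
  moreover have "N = (sqrt N)\<^sup>2" using x by simp
  ultimately have "(norm Y)\<^sup>2 \<le> (R * sqrt N)\<^sup>2"
    using norm_power2_le_norm_gram[of Y] by (simp add: N_def power_mult_distrib)
  then have Y: "norm Y \<le> R * sqrt N"
    by (rule power2_le_imp_le) (use R x in simp)
  have "k * N\<^sup>2 < finner (grad_H Ys Y) Y"
    using finner_grad_H_gt[of \<gamma> Ys Y] \<gamma> gt by (simp add: k_def N_def)
  also have "\<dots> \<le> G * norm Y"
    by (simp add: finner_eq_inner G_def norm_cauchy_schwarz)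
  also have "\<dots> \<le> G * (R * sqrt N)"
    using Y by (intro mult_left_mono) (simp_all add: G_def)
  \<comment> \<open>This splitting lets the \<open>sqrt N\<close> from the bound on
    \<open>norm Y\<close> cancel.\<close>
  also have "N\<^sup>2 = N powr (3/2) * sqrt N"
    using x powr_add[of N "3/2" "1/2"] by (simp add: powr_half_sqrt)
  finally have "(k * N powr (3/2)) * sqrt N < (G * R) * sqrt N" by (simp add: mult_ac)
  then have "k * N powr (3/2) < G * R" using x by simp
  moreover have "k * x powr (3/2) \<le> k * N powr (3/2)"
    using k x by (intro mult_left_mono powr_mono2) auto
  ultimately show ?thesis
    using R by (simp add: k_def x_def G_def R_def pos_divide_less_eq)
qed

section \<open>Gradient bounds on the three regions, with explicit positive constants\<close>

text \<open>The guard \<open>\<beta> \<ge> 1 / sqrt 3\<close> is there because the cubic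
  \<open>s^3 - s t^2\<close> decreases on \<open>0 \<le> s \<le> t / sqrt 3\<close>, so the
  comparison of cubics can fail for smaller \<open>\<beta>\<close>. At \<open>\<beta> = 0\<close>
  and \<open>\<gamma> \<ge> 1\<close> the point \<open>Y = Ys\<close>, with zero gradient, lies in
  \<open>R3_2\<close>, whence \<open>\<beta> > 0\<close>.\<close>

theorem theorem11:
  fixes Ys :: "real^'r^'p" and \<mu> \<alpha> \<beta> \<gamma> :: real
  assumes "CARD('r) \<le> CARD('p)"
    and "Ys \<in> full_col_rank"
    and "\<mu> \<ge> 0" "\<alpha> \<ge> 0" "\<beta> \<ge> 0" "\<gamma> \<ge> 0"
  shows
    "(\<forall>Y\<in>R3_1 \<mu> \<alpha> \<beta> \<gamma> Ys.
        norm (grad_H Ys Y) > \<alpha> * \<mu> * sing_val Ys CARD('r) ^ 3 / (4 * kappa Ys)) \<and>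
     (\<forall>Y\<in>R3_2 \<beta> \<gamma> Ys.
        norm (grad_H Ys Y)
          \<ge> 2 * (spectral_norm Y ^ 3 - spectral_norm Y * spectral_norm Ys ^ 2) \<and>
        (\<beta> \<ge> 1 / sqrt 3 \<longrightarrow>
          2 * (spectral_norm Y ^ 3 - spectral_norm Y * spectral_norm Ys ^ 2)
            > 2 * (\<beta> ^ 3 - \<beta>) * spectral_norm Ys ^ 3) \<and>
        (\<beta> > 0 \<longrightarrow>
          norm (grad_H Ys Y) > 2 * (\<beta> ^ 3 - \<beta>) * spectral_norm Ys ^ 3)) \<and>
     (\<gamma> > 0 \<longrightarrow>
       (\<forall>Y\<in>R3_3 \<gamma> Ys.
          finner (grad_H Ys Y) Y > 2 * (1 - 1 / \<gamma>) * (norm (Y ** transpose Y))\<^sup>2)) \<and>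
     (\<beta> > 1 \<and> \<gamma> > 1 \<longrightarrow>
       (let c1 = \<alpha> * \<mu> * sing_val Ys CARD('r) ^ 3 / (4 * kappa Ys);
            c2 = 2 * (\<beta> ^ 3 - \<beta>) * spectral_norm Ys ^ 3;
            c3 = 2 * (1 - 1 / \<gamma>) * (\<gamma> * norm (Ys ** transpose Ys)) powr (3/2)
                   / real CARD('r) powr (1/4)
        in c1 \<ge> 0 \<and> (\<alpha> > 0 \<and> \<mu> > 0 \<longrightarrow> c1 > 0) \<and> c2 > 0 \<and> c3 > 0 \<and>
           (\<forall>Y\<in>R3_1 \<mu> \<alpha> \<beta> \<gamma> Ys. norm (grad_H Ys Y) > c1) \<and>
           (\<forall>Y\<in>R3_2 \<beta> \<gamma> Ys. norm (grad_H Ys Y) > c2) \<and>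
           (\<forall>Y\<in>R3_3 \<gamma> Ys. norm (grad_H Ys Y) > c3)))"
proof -
  have t: "spectral_norm Ys > 0" using assms(2) by (rule spectral_norm_pos)
  have "Ys ** transpose Ys \<noteq> 0"
  proof
    assume "Ys ** transpose Ys = 0"
    then have "Ys = 0" using norm_power2_le_norm_gram[of Ys] by simp
    then show False using t by (simp add: spectral_norm_def onorm_zero)
  qed
  then have X: "norm (Ys ** transpose Ys) > 0" by simp
  have sv: "sing_val Ys CARD('r) > 0" and ka: "kappa Ys > 0"
    using assms(2) by (simp_all add: sing_val_pos kappa_pos Suc_leI)
  have ii: "2 * (spectral_norm Y ^ 3 - spectral_norm Y * spectral_norm Ys ^ 2)
      > 2 * (\<beta> ^ 3 - \<beta>) * spectral_norm Ys ^ 3"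
    if "Y \<in> R3_2 \<beta> \<gamma> Ys" "\<beta> \<ge> 1 / sqrt 3" for Y
  proof -
    define s where "s = spectral_norm Y"
    define t where "t = spectral_norm Ys"
    have st: "s > \<beta> * t" using that(1) by (simp add: R3_2_def s_def t_def)
    define a where "a = \<beta> * t"
    have "0 < 1 / sqrt (3::real)" by simp
    then have \<beta>: "\<beta> \<ge> 0" using that(2) by (rule order_trans[OF less_imp_le])
    have "(1 / sqrt 3)\<^sup>2 \<le> \<beta>\<^sup>2" using that(2) by (rule power_mono) simp
    then have "1 \<le> 3 * \<beta>\<^sup>2" by (simp add: power_divide)
    then have "1 * t\<^sup>2 \<le> (3 * \<beta>\<^sup>2) * t\<^sup>2" by (rule mult_right_mono) simp
    \<comment> \<open>That is, \<open>a\<close> lies at or beyond the critical point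
      \<open>t / sqrt 3\<close> of the cubic.\<close>
    then have at: "t\<^sup>2 \<le> 3 * a\<^sup>2" by (simp add: a_def power_mult_distrib)
    have a: "a \<ge> 0" "s > a" using st t \<beta> by (simp_all add: a_def t_def)
    have "a\<^sup>2 < s\<^sup>2" using a(2,1) by (rule power_strict_mono) simp
    moreover have "a\<^sup>2 \<le> s * a" using a by (simp add: power2_eq_square mult_right_mono)
    ultimately have "s\<^sup>2 + s * a + a\<^sup>2 - t\<^sup>2 > 0" using at by linarith
    \<comment> \<open>The product is the difference of the values of \<open>x^3 - x t^2\<close> at
      \<open>s\<close> and at \<open>a\<close>.\<close>
    then have "(s - a) * (s\<^sup>2 + s * a + a\<^sup>2 - t\<^sup>2) > 0" using a by simp
    then have "(\<beta> ^ 3 - \<beta>) * t ^ 3 < s ^ 3 - s * t\<^sup>2"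
      by (simp add: a_def algebra_simps power2_eq_square power3_eq_cube)
    then show ?thesis by (simp only: s_def t_def mult.assoc mult_less_cancel_left_pos zero_less_numeral)
  qed
  have ii': "norm (grad_H Ys Y) > 2 * (\<beta> ^ 3 - \<beta>) * spectral_norm Ys ^ 3"
    if Y: "Y \<in> R3_2 \<beta> \<gamma> Ys" and \<beta>: "\<beta> > 0" for Y
  proof (cases "\<beta> \<ge> 1 / sqrt 3")
    case True
    then show ?thesis using ii[OF Y] norm_grad_H_ge[of Y Ys] by linarith
  next
    \<comment> \<open>Here \<open>0 < \<beta> < 1\<close>, so the claimed bound is negative.\<close>
    case False
    moreover have "1 / sqrt 3 < (1::real)" by simp
    ultimately have "\<beta> < 1" by linarith
    then have "\<beta> * \<beta>\<^sup>2 < \<beta>" using \<beta> by (simp add: power_less_one_iff)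
    then have "(\<beta> ^ 3 - \<beta>) * spectral_norm Ys ^ 3 < 0"
      using t by (intro mult_neg_pos) (simp_all add: power3_eq_cube power2_eq_square)
    then show ?thesis using norm_ge_zero[of "grad_H Ys Y"] by linarith
  qed
  have c2: "2 * (\<beta> ^ 3 - \<beta>) * spectral_norm Ys ^ 3 > 0" if "\<beta> > 1"
    using power_strict_increasing[of 1 3 \<beta>] that t by simp
  have c1: "\<alpha> * \<mu> * sing_val Ys CARD('r) ^ 3 / (4 * kappa Ys) \<ge> 0"
    using sv ka assms(3,4) by simp
  have c1': "\<alpha> * \<mu> * sing_val Ys CARD('r) ^ 3 / (4 * kappa Ys) > 0" if "\<alpha> > 0" "\<mu> > 0"
    using sv ka that by simp
  have c3: "2 * (1 - 1 / \<gamma>) * (\<gamma> * norm (Ys ** transpose Ys)) powr (3/2)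
      / real CARD('r) powr (1/4) > 0" if "\<gamma> > 1"
    using that X by (intro divide_pos_pos mult_pos_pos) (auto simp: powr_gt_zero)
  show ?thesis
    unfolding Let_def
  proof (intro conjI ballI impI; (elim conjE)?)
    fix Y assume "Y \<in> R3_3 \<gamma> Ys" "\<gamma> > 0"
    then show "finner (grad_H Ys Y) Y > 2 * (1 - 1 / \<gamma>) * (norm (Y ** transpose Y))\<^sup>2"
      by (simp only: R3_3_def mem_Collect_eq finner_grad_H_gt)
  next
    fix Y assume "Y \<in> R3_3 \<gamma> Ys" "\<gamma> > 1"
    then show "norm (grad_H Ys Y) > 2 * (1 - 1 / \<gamma>) * (\<gamma> * norm (Ys ** transpose Ys)) powr (3/2)
        / real CARD('r) powr (1/4)"
      by (simp only: R3_3_def mem_Collect_eq norm_grad_H_gt)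
  \<comment> \<open>The bound on \<open>R3_1\<close> is itself a condition for membership.\<close>
  qed (use ii ii' c1 c1' c2 c3 norm_grad_H_ge in \<open>simp_all only: R3_1_def mem_Collect_eq\<close>)
qed

end
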